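(* Let $K\ge 1$ and $S\ge 1$ be integers, and put $$a=\frac{3K(K+2)}{K+1},\qquad b=\frac{3(K+2)}{K+1}.$$ Let $\bar\gamma_1,\dots,\bar\gamma_S$ be independent, identically distributed random variables with distribution $\mathrm{Beta}(a,b)$. Then $$\mathbb{E}\Big[\max_{1\le s\le S}\bar\gamma_s\Big]=\frac{S}{(\mathbb{B}(a,b))^S}\sum_{k_1=0}^\infty\cdots\sum_{k_{S-1}=0}^\infty\frac{(1-b)_{k_1}\cdots(1-b)_{k_{S-1}}}{(a+k_1)\cdots(a+k_{S-1})\,k_1!\cdots k_{S-1}!}\;\mathbb{B}(aS+k_1+\cdots+k_{S-1}+1,\,b).$$
   Context: $\mathbb{B}(p,q)=\int_0^1 x^{p-1}(1-x)^{q-1}\,dx$ ($p,q>0$) is the beta function. $\mathrm{Beta}(a,b)$ is the distribution on $[0,1]$ with density $x^{a-1}(1-x)^{b-1}/\mathbb{B}(a,b)$. $(x)_k=x(x+1)\cdots(x+k-1)$ is the Pochhammer symbol, with $(x)_0=1$. For $S=1$ there are no summation indices, and the right-hand side is read as $\mathbb{B}(a+1,b)/\mathbb{B}(a,b)$. *)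

theory Defs
  imports "HOL-Probability.Probability"
begin

(* The library's Beta is Gamma a * Gamma b / Gamma (a + b); for a, b > 0 it equals the
   integral of x powr (a - 1) * (1 - x) powr (b - 1) over {0..1}: has_integral_Beta_real. *)

definition beta_density :: "real \<Rightarrow> real \<Rightarrow> real \<Rightarrow> real" where
  "beta_density a b x =
     (if 0 \<le> x \<and> x \<le> 1 then x powr (a - 1) * (1 - x) powr (b - 1) / Beta a b else 0)"

(* iter_suminf n f is the n-fold iterated series
     (SUM k1. SUM k2. ... SUM kn. f [k1, ..., kn]),
   and equals f [] for n = 0.  Since suminf is unspecified on divergent series,
   iter_summable n f records that each of the nested series converges. *)

primrec iter_suminf :: "nat \<Rightarrow> (nat list \<Rightarrow> real) \<Rightarrow> real" where
  "iter_suminf 0 f = f []"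
| "iter_suminf (Suc n) f = (\<Sum>k. iter_suminf n (\<lambda>ks. f (k # ks)))"

primrec iter_summable :: "nat \<Rightarrow> (nat list \<Rightarrow> real) \<Rightarrow> bool" where
  "iter_summable 0 f \<longleftrightarrow> True"
| "iter_summable (Suc n) f \<longleftrightarrow>
     (\<forall>k. iter_summable n (\<lambda>ks. f (k # ks))) \<and>
     summable (\<lambda>k. iter_suminf n (\<lambda>ks. f (k # ks)))"

definition max_beta_term :: "nat \<Rightarrow> real \<Rightarrow> real \<Rightarrow> nat list \<Rightarrow> real" where
  "max_beta_term S a b ks =
     (\<Prod>k\<leftarrow>ks. pochhammer (1 - b) k) / ((\<Prod>k\<leftarrow>ks. a + real k) * (\<Prod>k\<leftarrow>ks. fact k))
     * Beta (a * real S + real (sum_list ks) + 1) b"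

end

theory Submission
  imports Defs
begin

text \<open>
  Since $b > 1$, the coefficients of $(1-t)^{b-1}$ are absolutely summable, so integrating the
  binomial series termwise gives $F(x) = \int_0^x t^{a-1}(1-t)^{b-1}\,dt =
  \sum_k \frac{(1-b)_k}{k!\,(a+k)} x^{a+k}$ on all of $[0,1]$. The maximum has density
  proportional to $x^{a-1}(1-x)^{b-1} F(x)^{S-1}$, and its mean is obtained by expanding one factor
  $F$ at a time: each expansion turns the weight $x^{p-1}(1-x)^{b-1}$ into $x^{p+a+k-1}(1-x)^{b-1}$,
  so the nested series arises by induction on the number of factors, with $p$ arbitrary.
\<close>

section \<open>Iterated series and the binomial coefficients\<close>

lemma iter_suminf_cmult:
  assumes "iter_summable n f"
  shows "iter_summable n (\<lambda>ks. c * f ks) \<and> iter_suminf n (\<lambda>ks. c * f ks) = c * iter_suminf n f"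
  using assms
proof (induction n arbitrary: f)
  case (Suc n)
  then have "\<And>k. iter_summable n (\<lambda>ks. c * f (k # ks)) \<and>
      iter_suminf n (\<lambda>ks. c * f (k # ks)) = c * iter_suminf n (\<lambda>ks. f (k # ks))"
    and "summable (\<lambda>k. iter_suminf n (\<lambda>ks. f (k # ks)))"
    by auto
  then show ?case
    by (simp add: suminf_mult summable_mult)
qed simp

lemma summable_abs_pochhammer_fact:
  fixes b :: real
  assumes "b \<ge> 1"
  shows "summable (\<lambda>k. \<bar>pochhammer (1 - b) k / fact k\<bar>)"
proof -
  \<comment> \<open>the partial sums of the series, whose absolute values eventually decrease, so that the
    absolute values of the terms telescope\<close>
  define d where "d k = pochhammer (2 - b) k / fact k" for k
  \<comment> \<open>For \<open>m \<ge> b\<close> the ratio \<open>(2 - b + m) / (m + 1)\<close> of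
    consecutive values of \<open>d\<close> is positive. It falls short of 1 by exactly
    \<open>(b - 1) / (m + 1)\<close>, the nonnegative factor that turns
    \<open>\<bar>d m\<bar>\<close> into the absolute value of the term with index
    \<open>m + 1\<close>.\<close>
  define N where "N = nat \<lceil>b\<rceil>"
  have N: "b \<le> real N"
    unfolding N_def by linarith
  have rec: "d (Suc k) = d k * ((2 - b + real k) / real (Suc k))" for k
    by (simp add: d_def pochhammer_rec' mult_ac)
  have c: "pochhammer (1 - b) (Suc k) / fact (Suc k) = d k * ((1 - b) / real (Suc k))" for k
    by (simp add: d_def pochhammer_rec mult_ac)
  have eq: "\<bar>pochhammer (1 - b) (Suc (k + N)) / fact (Suc (k + N))\<bar>
      = \<bar>d (k + N)\<bar> - \<bar>d (Suc k + N)\<bar>" for k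
  proof -
    define m where "m = k + N"
    have m: "real m \<ge> b" using N by (simp add: m_def)
    have "\<bar>d (Suc m)\<bar> = \<bar>d m\<bar> * ((2 - b + real m) / real (Suc m))"
      unfolding rec abs_mult using m by simp
    moreover have "\<bar>pochhammer (1 - b) (Suc m) / fact (Suc m)\<bar> = \<bar>d m\<bar> * ((b - 1) / real (Suc m))"
      unfolding c abs_mult using assms by simp
    moreover have "(b - 1) / real (Suc m) = 1 - (2 - b + real m) / real (Suc m)"
      by (simp add: field_simps)
    ultimately have "\<bar>pochhammer (1 - b) (Suc m) / fact (Suc m)\<bar> = \<bar>d m\<bar> - \<bar>d (Suc m)\<bar>"
      by (simp only: right_diff_distrib mult_1_right)
    then show ?thesis
      by (simp only: m_def add_Suc)
  qed
  have "decseq (\<lambda>k. \<bar>d (k + N)\<bar>)"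
  proof (rule decseq_SucI)
    show "\<bar>d (Suc k + N)\<bar> \<le> \<bar>d (k + N)\<bar>" for k
      using eq[of k] by (metis abs_ge_zero diff_ge_0_iff_ge)
  qed
  then obtain L where "(\<lambda>k. \<bar>d (k + N)\<bar>) \<longlonglongrightarrow> L"
    using decseq_convergent[of _ 0] by (metis abs_ge_zero)
  then have "summable (\<lambda>k. \<bar>d (k + N)\<bar> - \<bar>d (Suc k + N)\<bar>)"
    by (rule telescope_summable')
  then have "summable (\<lambda>k. \<bar>pochhammer (1 - b) (k + Suc N) / fact (k + Suc N)\<bar>)"
    using eq by simp
  then show ?thesis
    by (subst (asm) summable_iff_shift)
qed

section \<open>Beta weights and their integrals\<close>

text \<open>A gauge integral may converge only conditionally; nonnegativity excludes this, so its
  value is also the Lebesgue integral. This carries the integrals of the beta weight, of powers and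
  of the density over to \<open>lborel\<close>.\<close>

lemma has_bochner_integral_lborel_indicator:
  fixes f :: "real \<Rightarrow> real"
  assumes f: "f \<in> borel_measurable borel" and A: "A \<in> sets borel"
    and nonneg: "\<And>x. x \<in> A \<Longrightarrow> 0 \<le> f x" and I: "(f has_integral I) A"
  shows "has_bochner_integral lborel (\<lambda>x. indicator A x * f x) I"
proof (rule has_bochner_integral_nn_integral)
  show "(\<lambda>x. indicator A x * f x) \<in> borel_measurable lborel"
    using f A by simp
  show "AE x in lborel. 0 \<le> indicator A x * f x"
    using nonneg by (auto simp: indicator_def)
  show "0 \<le> I"
    using has_integral_nonneg[OF I] nonneg by simp
  show "(\<integral>\<^sup>+ x. ennreal (indicator A x * f x) \<partial>lborel) = ennreal I"
    using nn_integral_has_integral_lebesgue[OF nonneg I] by simp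
qed

definition beta_weight :: "real \<Rightarrow> real \<Rightarrow> real \<Rightarrow> real" where
  "beta_weight p b x = indicator {0..1} x * (x powr (p - 1) * (1 - x) powr (b - 1))"

lemma beta_weight_nonneg: "0 \<le> beta_weight p b x"
  by (simp add: beta_weight_def)

lemma has_bochner_integral_beta_weight:
  assumes "p > 0" "b > 0"
  shows "has_bochner_integral lborel (beta_weight p b) (Beta p b)"
  unfolding beta_weight_def[abs_def]
  by (rule has_bochner_integral_lborel_indicator)
     (use has_integral_Beta_real[OF assms] in auto)

text \<open>This absorbs the powers of \<open>x\<close> from an expanded factor \<open>F\<close>
  into the first parameter. It holds at \<open>x = 0\<close> as well because
  \<open>0 powr s = 0\<close> for every exponent, including \<open>s = 0\<close>.\<close>

lemma beta_weight_add:
  "beta_weight (p + s) b x = beta_weight p b x * x powr s"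
  by (simp add: beta_weight_def powr_add[symmetric] algebra_simps)

section \<open>Weighted powers of a series as iterated series\<close>

text \<open>Sum and integral may be exchanged because \<open>x powr (a + real k) \<le> 1\<close> on
  the unit interval: the term with index \<open>k\<close> is dominated by
  \<open>\<bar>d k\<bar>\<close> times one function independent of \<open>k\<close>. That function
  is the absolute value of the integrand with one factor \<open>F\<close> fewer, which is why
  integrability is part of the inductive claim.\<close>

lemma iter_suminf_beta_integral:
  fixes d :: "nat \<Rightarrow> real" and F :: "real \<Rightarrow> real"
  assumes d: "summable (\<lambda>k. \<bar>d k\<bar>)" and a: "a > 0" and b: "b > 0"
    and F: "\<And>x. 0 \<le> x \<Longrightarrow> x \<le> 1 \<Longrightarrow> (\<lambda>k. d k * x powr (a + real k)) sums F x"
    and p: "p > 0"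
  shows "integrable lborel (\<lambda>x. beta_weight p b x * F x ^ n) \<and>
    iter_summable n (\<lambda>ks. (\<Prod>k\<leftarrow>ks. d k) * Beta (p + a * real n + real (sum_list ks)) b) \<and>
    iter_suminf n (\<lambda>ks. (\<Prod>k\<leftarrow>ks. d k) * Beta (p + a * real n + real (sum_list ks)) b) =
      (\<integral>x. beta_weight p b x * F x ^ n \<partial>lborel)"
  using p
proof (induction n arbitrary: p)
  case 0
  then show ?case
    using has_bochner_integral_beta_weight[OF 0 b] by (simp add: has_bochner_integral_iff)
next
  case (Suc n)
  \<comment> \<open>\<open>g k\<close> is the summand of the integrand once a single factor
    \<open>F\<close> has been expanded. \<open>T q\<close> is the summand over the remaining
    \<open>n\<close> indices when the weight has parameter \<open>q\<close>.\<close>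
  define g where "g k x = d k * (beta_weight (p + (a + real k)) b x * F x ^ n)" for k x
  define T where "T q ks = (\<Prod>k\<leftarrow>ks. d k) * Beta (q + a * real n + real (sum_list ks)) b"
    for q ks
  have IH: "integrable lborel (\<lambda>x. beta_weight q b x * F x ^ n)" "iter_summable n (T q)"
      "iter_suminf n (T q) = (\<integral>x. beta_weight q b x * F x ^ n \<partial>lborel)" if "q > 0" for q
    using Suc.IH[OF that] by (simp_all add: T_def[abs_def])
  have pos: "p + (a + real k) > 0" for k
    using Suc.prems a by simp
  have int_g: "integrable lborel (g k)" for k
    unfolding g_def[abs_def] by (intro integrable_mult_right IH(1) pos)
  have sums_g: "(\<lambda>k. g k x) sums (beta_weight p b x * F x ^ Suc n)" for x
  proof (cases "0 \<le> x \<and> x \<le> 1")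
    case True
    have "(\<lambda>k. (beta_weight p b x * F x ^ n) * (d k * x powr (a + real k)))
        sums ((beta_weight p b x * F x ^ n) * F x)"
      using True by (intro sums_mult F) auto
    then show ?thesis
      by (simp add: g_def beta_weight_add mult_ac)
  next
    case False
    then show ?thesis
      by (simp add: g_def beta_weight_def)
  qed
  have le_g: "norm (g k x) \<le> \<bar>d k\<bar> * \<bar>beta_weight p b x * F x ^ n\<bar>" for k x
  proof (cases "0 \<le> x \<and> x \<le> 1")
    case True
    then have "x powr (a + real k) \<le> 1"
      using a by (intro powr_le1) auto
    then have "\<bar>beta_weight p b x * F x ^ n\<bar> * x powr (a + real k)
        \<le> \<bar>beta_weight p b x * F x ^ n\<bar>"
      by (intro mult_left_le) auto
    then have "\<bar>d k\<bar> * (\<bar>beta_weight p b x * F x ^ n\<bar> * x powr (a + real k))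
        \<le> \<bar>d k\<bar> * \<bar>beta_weight p b x * F x ^ n\<bar>"
      by (intro mult_left_mono) auto
    then show ?thesis
      by (simp add: g_def beta_weight_add abs_mult mult_ac)
  next
    case False
    then show ?thesis
      by (simp add: g_def beta_weight_def)
  qed
  have int_p: "integrable lborel (\<lambda>x. \<bar>beta_weight p b x * F x ^ n\<bar>)"
    using IH(1)[OF Suc.prems] by (rule integrable_abs)
  have summ_x: "AE x in lborel. summable (\<lambda>k. norm (g k x))"
  proof (rule AE_I2)
    fix x :: real
    show "summable (\<lambda>k. norm (g k x))"
      by (rule summable_comparison_test'[OF summable_mult2[OF d,
            of "\<bar>beta_weight p b x * F x ^ n\<bar>"], of 0]) (use le_g in auto)
  qed
  have summ_i: "summable (\<lambda>k. \<integral>x. norm (g k x) \<partial>lborel)"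
  proof (rule summable_comparison_test'[OF summable_mult2[OF d,
          of "\<integral>x. \<bar>beta_weight p b x * F x ^ n\<bar> \<partial>lborel"], of 0])
    fix k :: nat
    have "(\<integral>x. norm (g k x) \<partial>lborel)
        \<le> (\<integral>x. \<bar>d k\<bar> * \<bar>beta_weight p b x * F x ^ n\<bar> \<partial>lborel)"
      by (intro integral_mono integrable_norm int_g integrable_mult_right int_p le_g)
    then show "norm (\<integral>x. norm (g k x) \<partial>lborel)
        \<le> \<bar>d k\<bar> * (\<integral>x. \<bar>beta_weight p b x * F x ^ n\<bar> \<partial>lborel)"
      by simp
  qed
  have suminf_g: "(\<Sum>k. g k x) = beta_weight p b x * F x ^ Suc n" for x
    using sums_g by (rule sums_unique[symmetric])
  have int: "integrable lborel (\<lambda>x. beta_weight p b x * F x ^ Suc n)"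
    using integrable_suminf[OF int_g summ_x summ_i] by (simp only: suminf_g)
  have sums: "(\<lambda>k. \<integral>x. g k x \<partial>lborel) sums (\<integral>x. beta_weight p b x * F x ^ Suc n \<partial>lborel)"
    using sums_integral[OF int_g summ_x summ_i] by (simp only: suminf_g)
  let ?f = "\<lambda>ks. (\<Prod>k\<leftarrow>ks. d k) * Beta (p + a * real (Suc n) + real (sum_list ks)) b"
  \<comment> \<open>The head index contributes the factor \<open>d k\<close> and moves
    \<open>a + k\<close> into the parameter, so the inner series is the induction hypothesis at
    \<open>p + (a + k)\<close>, scaled.\<close>
  have f_Cons: "(\<lambda>ks. ?f (k # ks)) = (\<lambda>ks. d k * T (p + (a + real k)) ks)" for k
    by (simp add: T_def fun_eq_iff algebra_simps)
  have "iter_suminf n (\<lambda>ks. ?f (k # ks)) = (\<integral>x. g k x \<partial>lborel)" for k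
    unfolding f_Cons g_def using iter_suminf_cmult[OF IH(2)[OF pos]] IH(3)[OF pos] by simp
  moreover have "iter_summable n (\<lambda>ks. ?f (k # ks))" for k
    unfolding f_Cons using iter_suminf_cmult[OF IH(2)[OF pos]] by blast
  ultimately show ?case
    using int sums by (simp only: iter_suminf.simps iter_summable.simps sums_iff) simp
qed

section \<open>Power series of the incomplete beta function\<close>

text \<open>The endpoint \<open>x = 1\<close> lies on the boundary of the disc of convergence of the
  binomial series. Absolute summability of its coefficients supplies a bound on the terms that is
  valid up to this endpoint.\<close>

lemma incomplete_beta_sums:
  fixes a b x :: real
  assumes a: "a > 0" and b: "b \<ge> 1" and x: "0 \<le> x" "x \<le> 1"
  shows "(\<lambda>k. pochhammer (1 - b) k / (fact k * (a + real k)) * x powr (a + real k)) sums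
    (\<integral>t. indicator {0..x} t * beta_weight a b t \<partial>lborel)"
proof -
  define c where "c k = pochhammer (1 - b) k / fact k" for k
  define h where "h k t = c k * (indicator {0..x} t * t powr (a + real k - 1))" for k t
  have powr: "has_bochner_integral lborel (\<lambda>t. indicator {0..x} t * t powr (a + real k - 1))
      (x powr (a + real k) / (a + real k))" for k
    by (rule has_bochner_integral_lborel_indicator)
       (use has_integral_powr_from_0[of "a + real k - 1" x] a x in auto)
  then have h: "has_bochner_integral lborel (h k) (c k * (x powr (a + real k) / (a + real k)))" for k
    unfolding h_def[abs_def] by (intro has_bochner_integral_mult_right) auto
  \<comment> \<open>The sign \<open>(- 1) ^ k\<close> from rewriting the generalized binomial
    coefficient as a Pochhammer symbol cancels the one from \<open>(- t) ^ k\<close>.\<close>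
  have binom: "(\<lambda>k. c k * t ^ k) sums (1 - t) powr (b - 1)" if "0 \<le> t" "t < 1" for t
  proof -
    have "(\<lambda>k. ((b - 1) gchoose k) * (- t) ^ k) sums (1 + - t) powr (b - 1)"
      using that by (intro gen_binomial_real) auto
    moreover have "((b - 1) gchoose k) * (- t) ^ k = c k * t ^ k" for k
    proof -
      have "((b - 1) gchoose k) * (- t) ^ k = ((- 1) ^ k * (- 1) ^ k) * (c k * t ^ k)"
        unfolding power_minus[of t k] by (simp add: c_def gbinomial_pochhammer)
      then show ?thesis
        by (simp flip: power_mult_distrib)
    qed
    ultimately show ?thesis by simp
  qed
  have summable_c: "summable (\<lambda>k. \<bar>c k\<bar>)"
    unfolding c_def using b by (rule summable_abs_pochhammer_fact)
  have h_eq: "h k t = indicator {0..x} t * t powr (a - 1) * (c k * t ^ k)" if "t \<noteq> 0" for k t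
  proof (cases "t \<in> {0..x}")
    case True
    with that have "t > 0" by simp
    then have "t powr (a + real k - 1) = t powr (a - 1) * t ^ k"
      by (simp add: powr_realpow[symmetric] powr_add[symmetric] algebra_simps)
    then show ?thesis
      by (simp add: h_def)
  qed (simp add: h_def)
  \<comment> \<open>Two null points are removed: \<open>h_eq\<close> converts between
    \<open>powr\<close> and natural powers for positive \<open>t\<close>, and \<open>binom\<close>
    requires \<open>t < 1\<close>.\<close>
  have AE_01: "AE t in lborel. t \<noteq> 0 \<and> t \<noteq> (1::real)"
    using AE_lborel_singleton[of "0::real"] AE_lborel_singleton[of "1::real"] by eventually_elim simp
  have summ_x: "AE t in lborel. summable (\<lambda>k. norm (h k t))"
    using AE_01
  proof eventually_elim
    case (elim t)
    show ?case
    proof (cases "t \<in> {0..x}")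
      case True
      show ?thesis
      proof (rule summable_comparison_test'[OF summable_mult2[OF summable_c, of "t powr (a - 1)"], of 0])
        fix k :: nat
        have "\<bar>c k\<bar> * t ^ k \<le> \<bar>c k\<bar>"
          using True x by (intro mult_left_le power_le_one) auto
        then have "t powr (a - 1) * (\<bar>c k\<bar> * t ^ k) \<le> t powr (a - 1) * \<bar>c k\<bar>"
          by (intro mult_left_mono) auto
        then show "norm (norm (h k t)) \<le> \<bar>c k\<bar> * t powr (a - 1)"
          using True elim by (simp add: h_eq abs_mult mult_ac)
      qed
    qed (simp add: h_def)
  qed
  have norm_h: "(\<integral>t. norm (h k t) \<partial>lborel) = \<bar>c k\<bar> * (x powr (a + real k) / (a + real k))" for k
    using powr[of k] by (simp add: h_def abs_mult has_bochner_integral_iff)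
  have summ_i: "summable (\<lambda>k. \<integral>t. norm (h k t) \<partial>lborel)"
    unfolding norm_h
  proof (rule summable_comparison_test'[OF summable_mult2[OF summable_c, of "1 / a"], of 0])
    fix k :: nat
    have "x powr (a + real k) / (a + real k) \<le> 1 / a"
      using a x by (intro frac_le powr_le1) auto
    then show "norm (\<bar>c k\<bar> * (x powr (a + real k) / (a + real k))) \<le> \<bar>c k\<bar> * (1 / a)"
      using a by (simp add: abs_mult mult_left_mono del: times_divide_eq_right)
  qed
  have "(\<lambda>k. integral\<^sup>L lborel (h k)) sums (\<integral>t. (\<Sum>k. h k t) \<partial>lborel)"
    using h by (intro sums_integral summ_x summ_i) (auto simp: has_bochner_integral_iff)
  moreover have "(\<integral>t. (\<Sum>k. h k t) \<partial>lborel) = (\<integral>t. indicator {0..x} t * beta_weight a b t \<partial>lborel)"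
  proof (rule integral_cong_AE)
    show "(\<lambda>t. \<Sum>k. h k t) \<in> borel_measurable lborel"
      by (intro borel_measurable_integrable integrable_suminf summ_x summ_i)
         (use h in \<open>auto simp: has_bochner_integral_iff\<close>)
    show "(\<lambda>t. indicator {0..x} t * beta_weight a b t) \<in> borel_measurable lborel"
      unfolding beta_weight_def by simp
    show "AE t in lborel. (\<Sum>k. h k t) = indicator {0..x} t * beta_weight a b t"
      using AE_01
    proof eventually_elim
      case (elim t)
      show ?case
      proof (cases "t \<in> {0..x}")
        case True
        with elim x have "0 \<le> t" "t < 1" by auto
        from sums_mult[OF binom[OF this], of "t powr (a - 1)"]
        have "(\<lambda>k. h k t) sums (t powr (a - 1) * (1 - t) powr (b - 1))"
          using True elim by (simp add: h_eq)
        then show ?thesis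
          using True x by (simp add: sums_iff beta_weight_def)
      qed (simp add: h_def)
    qed
  qed
  ultimately show ?thesis
    using h by (simp add: has_bochner_integral_iff c_def)
qed

section \<open>Law of the maximum of i.i.d. variables\<close>

text \<open>By the chain rule the integrand is the derivative of the \<open>n\<close>-th power of
  the integral function of \<open>f\<close>. Since \<open>f\<close> vanishes on the negative axis,
  integrating over \<open>{..y}\<close> amounts to integrating over \<open>{0..y}\<close>; for
  \<open>y < 0\<close> both sides are 0, the right one because \<open>n \<ge> 1\<close>.\<close>

lemma nn_integral_power_integral:
  fixes f :: "real \<Rightarrow> real"
  assumes cont: "continuous_on UNIV f" and nonneg: "\<And>x. 0 \<le> f x" and zero: "\<And>x. x < 0 \<Longrightarrow> f x = 0"
    and n: "n \<ge> 1"
  shows "(\<integral>\<^sup>+x. ennreal (real n * f x * integral {0..x} f ^ (n - 1)) * indicator {..y} x \<partial>lborel)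
    = ennreal (integral {0..y} f ^ n)"
proof (cases "y < 0")
  case True
  then have "(\<lambda>x. ennreal (real n * f x * integral {0..x} f ^ (n - 1)) * indicator {..y} x) = (\<lambda>_. 0)"
    using zero by (auto simp: fun_eq_iff indicator_def)
  then show ?thesis
    using True n by (simp add: zero_power)
next
  case False
  let ?\<Phi> = "\<lambda>x. integral {0..x} f"
  have \<Phi>_nonneg: "0 \<le> ?\<Phi> x" for x
    by (intro integral_nonneg integrable_continuous_interval continuous_on_subset[OF cont] nonneg)
       auto
  have "((\<lambda>x. real n * f x * ?\<Phi> x ^ (n - 1)) has_integral (?\<Phi> y ^ n - ?\<Phi> 0 ^ n)) {0..y}"
  proof (rule fundamental_theorem_of_calculus)
    fix x assume x: "x \<in> {0..y}"
    have "(?\<Phi> has_real_derivative f x) (at x within {0..y})"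
      using x by (intro integral_has_real_derivative continuous_on_subset[OF cont]) auto
    from DERIV_power[OF this, of n]
    show "((\<lambda>x. ?\<Phi> x ^ n) has_vector_derivative real n * f x * ?\<Phi> x ^ (n - 1)) (at x within {0..y})"
      by (simp add: has_real_derivative_iff_has_vector_derivative mult_ac)
  qed (use False in auto)
  then have "((\<lambda>x. real n * f x * ?\<Phi> x ^ (n - 1)) has_integral ?\<Phi> y ^ n) {0..y}"
    using n by (simp add: zero_power)
  from nn_integral_has_integral_lebesgue'[OF _ this]
  have "(\<integral>\<^sup>+x. ennreal (real n * f x * ?\<Phi> x ^ (n - 1)) * indicator {0..y} x \<partial>lborel)
      = ennreal (?\<Phi> y ^ n)"
    using nonneg \<Phi>_nonneg by simp
  moreover have "(\<lambda>x. ennreal (real n * f x * ?\<Phi> x ^ (n - 1)) * indicator {..y} x)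
      = (\<lambda>x. ennreal (real n * f x * ?\<Phi> x ^ (n - 1)) * indicator {0..y} x)"
    using zero by (auto simp: fun_eq_iff indicator_def not_le)
  ultimately show ?thesis
    by simp
qed

text \<open>The maximum is at most \<open>y\<close> exactly when every variable is, so independence
  makes its distribution function the \<open>n\<close>-th power of the common one. The preceding
  lemma identifies the density; its case \<open>n = 1\<close> gives the common distribution
  function.\<close>

lemma (in prob_space) distributed_Max_iid:
  fixes f :: "real \<Rightarrow> real" and X :: "nat \<Rightarrow> 'a \<Rightarrow> real"
  assumes cont: "continuous_on UNIV f" and nonneg: "\<And>x. 0 \<le> f x" and zero: "\<And>x. x < 0 \<Longrightarrow> f x = 0"
    and n: "n \<ge> 1" and indep: "indep_vars (\<lambda>_. borel) X {1..n}"
    and distr: "\<And>s. s \<in> {1..n} \<Longrightarrow> distributed M lborel (X s) (\<lambda>x. ennreal (f x))"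
  shows "distributed M lborel (\<lambda>\<omega>. Max ((\<lambda>s. X s \<omega>) ` {1..n}))
    (\<lambda>x. ennreal (real n * f x * integral {0..x} f ^ (n - 1)))"
proof (rule distributedI_borel_atMost)
  let ?\<Phi> = "\<lambda>x. integral {0..x} f"
  have X: "X s \<in> borel_measurable M" if "s \<in> {1..n}" for s
    using distributed_measurable[OF distr[OF that]] by simp
  have \<Phi>_nonneg: "0 \<le> ?\<Phi> x" for x
    by (intro integral_nonneg integrable_continuous_interval continuous_on_subset[OF cont] nonneg)
       auto
  show "(\<lambda>\<omega>. Max ((\<lambda>s. X s \<omega>) ` {1..n})) \<in> borel_measurable M"
    using X by (intro borel_measurable_Max) auto
  \<comment> \<open>Monotonicity gives the measurability of \<open>?\<Phi>\<close> on the whole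
    line.\<close>
  have "mono ?\<Phi>"
  proof (rule monoI)
    show "?\<Phi> x \<le> ?\<Phi> y" if "x \<le> y" for x y
      by (intro integral_subset_le integrable_continuous_interval continuous_on_subset[OF cont])
         (use that nonneg in auto)
  qed
  then have [measurable]: "?\<Phi> \<in> borel_measurable borel"
    by (rule borel_measurable_mono)
  have [measurable]: "f \<in> borel_measurable borel"
    using cont by (rule borel_measurable_continuous_onI)
  show "(\<lambda>x. real n * f x * ?\<Phi> x ^ (n - 1)) \<in> borel_measurable borel"
    by measurable
  show "AE x in lborel. 0 \<le> real n * f x * ?\<Phi> x ^ (n - 1)"
    using nonneg \<Phi>_nonneg by simp
  show "(\<integral>\<^sup>+x. ennreal (real n * f x * ?\<Phi> x ^ (n - 1) * indicator {..y} x) \<partial>lborel)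
      = ennreal (?\<Phi> y ^ n)" for y
    using nn_integral_power_integral[OF cont nonneg zero n, of y]
    by (simp add: ennreal_mult'' ennreal_indicator)
  show "emeasure M {\<omega> \<in> space M. Max ((\<lambda>s. X s \<omega>) ` {1..n}) \<le> y} = ennreal (?\<Phi> y ^ n)" for y
  proof -
    have "prob (X s -` {..y} \<inter> space M) = ?\<Phi> y" if "s \<in> {1..n}" for s
    proof -
      have "emeasure M (X s -` {..y} \<inter> space M) = ennreal (?\<Phi> y)"
        using distributed_emeasure[OF distr[OF that], of "{..y}"]
          nn_integral_power_integral[OF cont nonneg zero, of 1 y] by simp
      then show ?thesis
        using \<Phi>_nonneg by (simp add: emeasure_eq_measure)
    qed
    moreover have "prob (\<Inter>s\<in>{1..n}. X s -` {..y} \<inter> space M)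
        = (\<Prod>s\<in>{1..n}. prob (X s -` {..y} \<inter> space M))"
      using n by (intro indep_varsD[OF indep]) auto
    moreover have "{\<omega> \<in> space M. Max ((\<lambda>s. X s \<omega>) ` {1..n}) \<le> y}
        = (\<Inter>s\<in>{1..n}. X s -` {..y} \<inter> space M)"
      using n by auto
    ultimately show ?thesis
      by (simp add: emeasure_eq_measure)
  qed
qed

section \<open>Regularity of the beta density\<close>

lemma beta_density_eq: "beta_density a b x = beta_weight a b x / Beta a b"
  by (simp add: beta_density_def beta_weight_def indicator_def)

lemma Beta_real_pos:
  fixes a b :: real
  assumes "a > 0" "b > 0"
  shows "Beta a b > 0"
  using assms by (simp add: Beta_def)

lemma beta_density_nonneg:
  assumes "a > 0" "b > 0"
  shows "0 \<le> beta_density a b x"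
  using Beta_real_pos[OF assms] by (simp add: beta_density_eq beta_weight_nonneg)

text \<open>Both exponents are positive, so the density tends to 0 at both ends of the interval.
  Clipping the bases at 0 yields one formula for the whole line, since \<open>0 powr s = 0\<close>
  reproduces the value 0 outside.\<close>

lemma continuous_on_beta_density:
  assumes "a > 1" "b > 1"
  shows "continuous_on UNIV (beta_density a b)"
proof -
  have "continuous_on UNIV (\<lambda>x. max 0 x powr (a - 1) * max 0 (1 - x) powr (b - 1) / Beta a b)"
    using assms Beta_real_pos[of a b]
    by (intro continuous_intros continuous_on_powr') auto
  moreover have "(\<lambda>x. max 0 x powr (a - 1) * max 0 (1 - x) powr (b - 1) / Beta a b) = beta_density a b"
    by (auto simp: fun_eq_iff beta_density_def max_def)
  ultimately show ?thesis
    by (simp only:)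
qed

lemma integral_beta_density:
  assumes "a > 1" "b > 1"
  shows "integral {0..x} (beta_density a b)
    = (\<integral>t. indicator {0..x} t * beta_weight a b t \<partial>lborel) / Beta a b"
proof -
  have "(beta_density a b has_integral integral {0..x} (beta_density a b)) {0..x}"
    by (intro integrable_integral integrable_continuous_interval
        continuous_on_subset[OF continuous_on_beta_density[OF assms]]) auto
  then have "has_bochner_integral lborel (\<lambda>t. indicator {0..x} t * beta_density a b t)
      (integral {0..x} (beta_density a b))"
    by (intro has_bochner_integral_lborel_indicator borel_measurable_continuous_onI
        continuous_on_beta_density) (use assms beta_density_nonneg in auto)
  then show ?thesis
    by (simp add: beta_density_eq has_bochner_integral_iff)
qed

text \<open>Merging the products shows the coefficients of the incomplete beta series, the form in
  which \<open>iter_suminf_beta_integral\<close> applies.\<close>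

lemma max_beta_term_eq:
  "max_beta_term S a b ks =
    (\<Prod>k\<leftarrow>ks. pochhammer (1 - b) k / (fact k * (a + real k)))
      * Beta (a * real S + real (sum_list ks) + 1) b"
proof -
  have "(\<Prod>k\<leftarrow>ks. pochhammer (1 - b) k) / ((\<Prod>k\<leftarrow>ks. a + real k) * (\<Prod>k\<leftarrow>ks. fact k))
      = (\<Prod>k\<leftarrow>ks. pochhammer (1 - b) k / (fact k * (a + real k)))"
    proof (induction ks)
    case (Cons k ks)
    show ?case
      by (simp add: Cons.IH[symmetric] mult_ac)
  qed simp
  then show ?thesis
    by (simp add: max_beta_term_def)
qed

section \<open>The mean of the maximum\<close>

lemma (in prob_space) expectation_Max_beta:
  fixes a b :: real and X :: "nat \<Rightarrow> 'a \<Rightarrow> real"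
  assumes a: "a > 1" and b: "b > 1" and S: "S \<ge> 1"
    and indep: "indep_vars (\<lambda>_. borel) X {1..S}"
    and distr: "\<And>s. s \<in> {1..S} \<Longrightarrow> distributed M lborel (X s) (\<lambda>x. ennreal (beta_density a b x))"
  shows "iter_summable (S - 1) (max_beta_term S a b) \<and>
    expectation (\<lambda>\<omega>. Max ((\<lambda>s. X s \<omega>) ` {1..S})) =
      real S / Beta a b ^ S * iter_suminf (S - 1) (max_beta_term S a b)"
proof -
  define F where "F x = (\<integral>t. indicator {0..x} t * beta_weight a b t \<partial>lborel)" for x
  define d where "d k = pochhammer (1 - b) k / (fact k * (a + real k))" for k
  have d: "summable (\<lambda>k. \<bar>d k\<bar>)"
  proof (rule summable_comparison_test'[OF summable_abs_pochhammer_fact[of b], of 0])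
    fix k :: nat
    have "\<bar>pochhammer (1 - b) k / fact k\<bar> / (a + real k) \<le> \<bar>pochhammer (1 - b) k / fact k\<bar> / 1"
      using a by (intro divide_left_mono) auto
    then show "norm \<bar>d k\<bar> \<le> \<bar>pochhammer (1 - b) k / fact k\<bar>"
      using a by (simp add: d_def abs_mult)
  qed (use b in auto)
  have F: "(\<lambda>k. d k * x powr (a + real k)) sums F x" if "0 \<le> x" "x \<le> 1" for x
    using incomplete_beta_sums[of a b x] a b that by (simp add: F_def d_def)
  have series: "iter_summable (S - 1) (max_beta_term S a b) \<and>
      iter_suminf (S - 1) (max_beta_term S a b) =
        (\<integral>x. beta_weight (a + 1) b x * F x ^ (S - 1) \<partial>lborel)"
  proof -
    \<comment> \<open>The factor \<open>x\<close> in the mean raises the weight parameter from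
      \<open>a\<close> to \<open>a + 1\<close>; the \<open>S - 1\<close> factors \<open>F\<close>
      add \<open>a * (S - 1)\<close>, giving \<open>a * S + 1\<close> in total.\<close>
    have "(\<lambda>ks. (\<Prod>k\<leftarrow>ks. d k) * Beta (a + 1 + a * real (S - 1) + real (sum_list ks)) b)
        = max_beta_term S a b"
      using S by (simp add: fun_eq_iff max_beta_term_eq d_def of_nat_diff algebra_simps)
    then show ?thesis
      using iter_suminf_beta_integral[of d a b F "a + 1" "S - 1"] d F a b by simp
  qed
  have B: "Beta a b > 0"
    using a b by (intro Beta_real_pos) auto
  have nonneg: "0 \<le> beta_density a b x" for x
    using a b by (intro beta_density_nonneg) auto
  have "0 \<le> integral {0..x} (beta_density a b)" for x
    using a b by (intro integral_nonneg integrable_continuous_interval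
        continuous_on_subset[OF continuous_on_beta_density] nonneg) auto
  then have "expectation (\<lambda>\<omega>. Max ((\<lambda>s. X s \<omega>) ` {1..S}))
      = (\<integral>x. real S * beta_density a b x * integral {0..x} (beta_density a b) ^ (S - 1) * x \<partial>lborel)"
    using a b S indep distr nonneg
    by (intro distributed_integral[symmetric, where g = "\<lambda>x. x"] distributed_Max_iid
        continuous_on_beta_density) (auto simp: beta_density_def)
  also have "\<dots> = (\<integral>x. real S / Beta a b ^ S * (beta_weight (a + 1) b x * F x ^ (S - 1)) \<partial>lborel)"
  proof (rule Bochner_Integration.integral_cong)
    fix x :: real
    \<comment> \<open>\<open>x powr 1\<close> equals \<open>x\<close> only for
      \<open>x \<ge> 0\<close>; for negative \<open>x\<close> both weights vanish.\<close>
    have "beta_weight (a + 1) b x = beta_weight a b x * x"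
      by (cases "0 \<le> x") (simp_all add: beta_weight_add, simp_all add: beta_weight_def)
    \<comment> \<open>One normalizing constant comes from the density, the other
      \<open>S - 1\<close> from the distribution functions.\<close>
    moreover have "Beta a b ^ S = Beta a b * Beta a b ^ (S - 1)"
      using S by (simp add: power_eq_if)
    ultimately show "real S * beta_density a b x * integral {0..x} (beta_density a b) ^ (S - 1) * x
        = real S / Beta a b ^ S * (beta_weight (a + 1) b x * F x ^ (S - 1))"
      using a b B by (simp add: integral_beta_density F_def beta_density_eq power_divide)
  qed simp
  also have "\<dots> = real S / Beta a b ^ S * iter_suminf (S - 1) (max_beta_term S a b)"
    using series by simp
  finally show ?thesis
    using series by simp
qed

theorem mainTheorem1:
  fixes K S :: nat and a b :: real
    and M :: "'w measure" and \<gamma> :: "nat \<Rightarrow> 'w \<Rightarrow> real"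
  assumes "K \<ge> 1" and "S \<ge> 1"
    and "a = 3 * real K * (real K + 2) / (real K + 1)"
    and "b = 3 * (real K + 2) / (real K + 1)"
    and "prob_space M"
    and "prob_space.indep_vars M (\<lambda>_. borel) \<gamma> {1..S}"
    and "\<And>s. s \<in> {1..S} \<Longrightarrow> distributed M lborel (\<gamma> s) (\<lambda>x. ennreal (beta_density a b x))"
  shows "iter_summable (S - 1) (max_beta_term S a b) \<and>
    prob_space.expectation M (\<lambda>\<omega>. Max ((\<lambda>s. \<gamma> s \<omega>) ` {1..S})) =
      real S / Beta a b ^ S * iter_suminf (S - 1) (max_beta_term S a b)"
proof -
  have b: "b > 1"
    unfolding assms(4) by (simp add: field_simps)
  have "a = real K * b"
    unfolding assms(3,4) by simp
  also have "\<dots> > 1"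
    using assms(1) b by (intro less_le_trans[OF b]) (simp add: mult_le_cancel_right1)
  finally have "a > 1" .
  then show ?thesis
    using assms b by (intro prob_space.expectation_Max_beta) auto
qed

end
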